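(* Consider functions $f\in D_0$. Define the following two operators for $a<x<b$: $$L_1f(x):=\left(e^{-W(x)}f'(x)\right)'+2\lambda_1e^{-W(x)}f(x),\qquad L_2f(x):=\left(e^{-W(x)}f'(x)\right)'+2\lambda_2e^{-W(x)}f(x),$$ where $\lambda_2>\lambda_1$. Let $\phi_1$ and $\phi_2$ (in $D_0$) be such that $L_1\phi_1=L_2\phi_2=0$. Then, between two zeros of $\phi_1$ there is a zero of $\phi_2$. Moreover, if $\phi_1(a)=\phi_2(a)=0$, then $\phi_2$ has at least as many zeros as $\phi_1$ on $[a,b]$.
   Context: $a<b$ are fixed real numbers and $W=\{W(x):x\in\mathbb{R}\}$ is a two-sided Brownian motion, of which one realization (the environment) is held fixed. $D_0$ is the set of differentiable functions $f$ such that $e^{-W(x)}f'(x)$ is differentiable.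
   Formalization: The formal theorem additionally assumes that φ₁ is not identically zero on [a,b]; without this the claim fails, e.g. for φ₁ ≡ 0 and φ₂ a nontrivial solution of L₂φ₂ = 0 with φ₂(a) = 0. *)

theory Defs
  imports "HOL-Probability.Probability" "HOL-Library.Equipollence"
begin

text \<open>Standard Brownian motion indexed by the whole real line and started at \<open>0\<close>. Note that
  \<^const>\<open>normal_density\<close> takes the standard deviation, not the variance.\<close>

locale two_sided_brownian_motion = prob_space M for M :: "'w measure" +
  fixes W :: "real \<Rightarrow> 'w \<Rightarrow> real"
  assumes random_variable_W: "random_variable borel (W x)"
    and start: "AE \<omega> in M. W 0 \<omega> = 0"
    and gaussian_increments: "x < y \<Longrightarrow>
      distributed M lborel (\<lambda>\<omega>. W y \<omega> - W x \<omega>) (normal_density 0 (sqrt (y - x)))"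
    and independent_increments: "strict_mono_on {..n::nat} t \<Longrightarrow>
      indep_vars (\<lambda>_. borel) (\<lambda>i \<omega>. W (t (Suc i)) \<omega> - W (t i) \<omega>) {..<n}"
    and continuous_paths: "AE \<omega> in M. continuous_on UNIV (\<lambda>x. W x \<omega>)"

text \<open>Below, \<open>w\<close> is one realization of the environment. Functions are considered on \<open>[a,b]\<close>, so
  derivatives are taken within \<open>[a,b]\<close>: at interior points they are ordinary derivatives, at \<open>a\<close>
  and \<open>b\<close> they are one-sided. A function that is differentiable on the whole line together with
  \<open>e\<^sup>-\<^sup>w f'\<close> therefore belongs to \<open>D0 w a b\<close>.\<close>

definition quasi_deriv :: "(real \<Rightarrow> real) \<Rightarrow> real \<Rightarrow> real \<Rightarrow> (real \<Rightarrow> real) \<Rightarrow> real \<Rightarrow> real" where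
  "quasi_deriv w a b f x = exp (- w x) * vector_derivative f (at x within {a..b})"

definition D0 :: "(real \<Rightarrow> real) \<Rightarrow> real \<Rightarrow> real \<Rightarrow> (real \<Rightarrow> real) set" where
  "D0 w a b = {f. f differentiable_on {a..b} \<and> quasi_deriv w a b f differentiable_on {a..b}}"

text \<open>Meant for \<open>f \<in> D0 w a b\<close> and \<open>a < x < b\<close>.\<close>

definition L_op ::
  "(real \<Rightarrow> real) \<Rightarrow> real \<Rightarrow> real \<Rightarrow> real \<Rightarrow> (real \<Rightarrow> real) \<Rightarrow> real \<Rightarrow> real" where
  "L_op w a b l f x =
     vector_derivative (quasi_deriv w a b f) (at x within {a..b}) + 2 * l * exp (- w x) * f x"

end

theory Submission
  imports Defs
begin

text \<open>
  The argument is pathwise: almost surely \<open>w = W(\<cdot>, \<omega>)\<close> is continuous, and the conclusion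
  holds for every continuous \<open>w\<close>. Writing \<open>g = e\<^sup>-\<^sup>w f'\<close>, the equation \<open>L f = 0\<close>
  becomes the first-order system \<open>f' = r g\<close>, \<open>g' = - q f\<close> with the continuous coefficients
  \<open>r = e\<^sup>w > 0\<close> and \<open>q = 2 l e\<^sup>-\<^sup>w\<close>. Since \<open>w\<close> itself is nowhere differentiable, this is the
  form in which the classical Sturm theory applies.

  Two facts about such a system carry the proof. First, a solution with \<open>f c = g c = 0\<close> vanishes
  identically, by a Gronwall estimate for the energy \<open>f\<^sup>2 + g\<^sup>2\<close>
  (\<open>solution_zero_of_zero_data\<close>). An accumulation point of zeros of \<open>f\<close> is a zero of both \<open>f\<close>
  and \<open>f'\<close>, so a nontrivial solution has finitely many zeros
  (\<open>finite_zeros\<close>). Secondly, for solutions to potentials \<open>q\<^sub>1 < q\<^sub>2\<close>, the Wronskian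
  \<open>f\<^sub>1 g\<^sub>2 - f\<^sub>2 g\<^sub>1\<close> has derivative \<open>- (q\<^sub>2 - q\<^sub>1) f\<^sub>1 f\<^sub>2\<close>. Between two
  consecutive zeros of \<open>f\<^sub>1\<close>, where \<open>f\<^sub>1\<close> may be taken positive, a positive \<open>f\<^sub>2\<close> would make the
  Wronskian strictly decrease, whereas its boundary values \<open>- f\<^sub>2 g\<^sub>1\<close> are nonpositive on the
  left and nonnegative on the right (\<open>no_common_positive_interval\<close>).

  The count of zeros is then combinatorial: each zero of \<open>f\<^sub>1\<close> other than \<open>a\<close> is matched with a
  zero of \<open>f\<^sub>2\<close> strictly between it and the preceding zero of \<open>f\<^sub>1\<close>, and \<open>a\<close> is matched with
  itself (\<open>zeros_lepoll\<close>).
\<close>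

section \<open>Solutions of Sturm--Liouville systems\<close>

text \<open>The quasi-derivative \<open>g\<close> is kept as a separate function because \<open>f\<close> need not be twice
  differentiable. The first equation includes the endpoints because the comparison argument reads
  off the sign of \<open>g\<close> at a zero of \<open>f\<close>, which may be an endpoint; the second only serves to
  differentiate energies and Wronskians, for which interior points and continuity suffice.\<close>

definition sturm_solution ::
  "(real \<Rightarrow> real) \<Rightarrow> (real \<Rightarrow> real) \<Rightarrow> real \<Rightarrow> real \<Rightarrow> (real \<Rightarrow> real) \<Rightarrow> (real \<Rightarrow> real) \<Rightarrow> bool" where
  "sturm_solution r q a b f g \<longleftrightarrow>
     (\<forall>x\<in>{a..b}. (f has_real_derivative r x * g x) (at x within {a..b})) \<and>
     continuous_on {a..b} g \<and>
     (\<forall>x\<in>{a<..<b}. (g has_real_derivative - q x * f x) (at x))"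

lemma sturm_solution_within:
  assumes "sturm_solution r q a b f g" "x \<in> {a..b}"
  shows "(f has_real_derivative r x * g x) (at x within {a..b})"
  using assms by (simp add: sturm_solution_def)

lemma sturm_solution_interior:
  assumes "sturm_solution r q a b f g" "x \<in> {a<..<b}"
  shows "(f has_real_derivative r x * g x) (at x)"
    and "(g has_real_derivative - q x * f x) (at x)"
  using assms sturm_solution_within[OF assms(1), of x]
  by (auto simp: sturm_solution_def at_within_Icc_at)

lemma sturm_solution_continuous:
  assumes "sturm_solution r q a b f g"
  shows "continuous_on {a..b} f" and "continuous_on {a..b} g"
  using assms unfolding sturm_solution_def
  by (auto intro!: DERIV_continuous_on)

lemma sturm_solution_scale:
  assumes "sturm_solution r q a b f g"
  shows "sturm_solution r q a b (\<lambda>x. s * f x) (\<lambda>x. s * g x)"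
  unfolding sturm_solution_def
proof (intro conjI ballI)
  fix x assume "x \<in> {a..b}"
  from DERIV_cmult[OF sturm_solution_within[OF assms this], of s]
  show "((\<lambda>x. s * f x) has_real_derivative r x * (s * g x)) (at x within {a..b})"
    by (simp add: mult_ac)
next
  show "continuous_on {a..b} (\<lambda>x. s * g x)"
    by (intro continuous_intros sturm_solution_continuous(2)[OF assms])
next
  fix x assume "x \<in> {a<..<b}"
  from DERIV_cmult[OF sturm_solution_interior(2)[OF assms this], of s]
  show "((\<lambda>x. s * g x) has_real_derivative - q x * (s * f x)) (at x)"
    by (simp add: mult_ac)
qed

section \<open>Uniqueness and finiteness of the zero set\<close>

text \<open>Gronwall's argument: with \<open>K\<close> bounding \<open>\<bar>r - q\<bar>\<close>, the energy \<open>E = f\<^sup>2 + g\<^sup>2\<close> satisfies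
  \<open>\<bar>E'\<bar> \<le> K E\<close>. Hence \<open>E\<close> cannot grow from the value \<open>0\<close>, neither to the right of \<open>c\<close> (where
  \<open>E e\<^sup>-\<^sup>K\<^sup>x\<close> decreases) nor to the left (where \<open>E e\<^sup>K\<^sup>x\<close> increases).\<close>

lemma solution_zero_of_zero_data:
  assumes sol: "sturm_solution r q a b f g"
    and cont: "continuous_on {a..b} r" "continuous_on {a..b} q"
    and c: "c \<in> {a..b}" "f c = 0" "g c = 0"
    and x: "x \<in> {a..b}"
  shows "f x = 0"
proof -
  define E where "E x = (f x)\<^sup>2 + (g x)\<^sup>2" for x
  have "bounded ((\<lambda>x. r x - q x) ` {a..b})"
    by (intro compact_imp_bounded compact_continuous_image continuous_intros cont compact_Icc)
  then obtain K where K: "\<And>x. x \<in> {a..b} \<Longrightarrow> \<bar>r x - q x\<bar> \<le> K"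
    unfolding bounded_iff by (metis imageI real_norm_def)
  have contE: "continuous_on {a..b} E"
    unfolding E_def by (intro continuous_intros sturm_solution_continuous[OF sol])
  have derivE: "(E has_real_derivative 2 * (r y - q y) * (f y * g y)) (at y)"
    if "y \<in> {a<..<b}" for y
    unfolding E_def
    by (rule derivative_eq_intros sturm_solution_interior[OF sol that] refl)+
       (simp add: algebra_simps)
  have boundE: "\<bar>2 * (r y - q y) * (f y * g y)\<bar> \<le> K * E y" if "y \<in> {a<..<b}" for y
  proof -
    have "2 * \<bar>f y * g y\<bar> \<le> E y"
      using sum_squares_bound[of "\<bar>f y\<bar>" "\<bar>g y\<bar>"] by (simp add: E_def abs_mult)
    then have "\<bar>r y - q y\<bar> * (2 * \<bar>f y * g y\<bar>) \<le> K * E y"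
      using that by (intro mult_mono K order_trans[OF abs_ge_zero K]) auto
    then show ?thesis by (simp only: abs_mult abs_numeral mult_ac)
  qed
  have "E x \<le> 0"
  proof (cases "c \<le> x")
    case True
    have "E x * exp (- K * x) \<le> E c * exp (- K * c)"
    proof (rule DERIV_nonpos_imp_decreasing_open[OF True])
      show "continuous_on {c..x} (\<lambda>x. E x * exp (- K * x))"
        using c x by (intro continuous_intros continuous_on_subset[OF contE]) auto
      fix y assume "c < y" "y < x"
      then have y: "y \<in> {a<..<b}" using c x by auto
      have "((\<lambda>x. E x * exp (- K * x)) has_real_derivative
              (2 * (r y - q y) * (f y * g y) - K * E y) * exp (- K * y)) (at y)"
        by (rule derivative_eq_intros derivE[OF y] refl)+ (simp add: algebra_simps)
      moreover have "(2 * (r y - q y) * (f y * g y) - K * E y) * exp (- K * y) \<le> 0"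
        using boundE[OF y] by (intro mult_nonpos_nonneg) auto
      ultimately show "\<exists>d. ((\<lambda>x. E x * exp (- K * x)) has_real_derivative d) (at y) \<and> d \<le> 0"
        by blast
    qed
    moreover have "E c = 0" using c by (simp add: E_def)
    ultimately show ?thesis by (simp add: mult_le_0_iff)
  next
    case False
    have "E x * exp (K * x) \<le> E c * exp (K * c)"
    proof (rule DERIV_nonneg_imp_increasing_open[of x c])
      show "x \<le> c" using False by simp
      show "continuous_on {x..c} (\<lambda>x. E x * exp (K * x))"
        using c x by (intro continuous_intros continuous_on_subset[OF contE]) auto
      fix y assume "x < y" "y < c"
      then have y: "y \<in> {a<..<b}" using c x by auto
      have "((\<lambda>x. E x * exp (K * x)) has_real_derivative
              (2 * (r y - q y) * (f y * g y) + K * E y) * exp (K * y)) (at y)"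
        by (rule derivative_eq_intros derivE[OF y] refl)+ (simp add: algebra_simps)
      moreover have "0 \<le> (2 * (r y - q y) * (f y * g y) + K * E y) * exp (K * y)"
        using boundE[OF y] by (intro mult_nonneg_nonneg) auto
      ultimately show "\<exists>d. ((\<lambda>x. E x * exp (K * x)) has_real_derivative d) (at y) \<and> 0 \<le> d"
        by blast
    qed
    moreover have "E c = 0" using c by (simp add: E_def)
    ultimately show ?thesis by (simp add: mult_le_0_iff)
  qed
  then show ?thesis by (simp add: E_def sum_power2_le_zero_iff)
qed

text \<open>Infinitely many zeros in the compact interval accumulate at some \<open>c\<close>. By continuity
  \<open>f c = 0\<close>, and the difference quotients of \<open>f\<close> at \<open>c\<close> vanish along the zeros, so \<open>f' c = 0\<close>.
  Both initial data at \<open>c\<close> are then zero.\<close>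

lemma finite_zeros:
  assumes sol: "sturm_solution r q a b f g"
    and cont: "continuous_on {a..b} r" "continuous_on {a..b} q"
    and pos: "\<And>x. x \<in> {a..b} \<Longrightarrow> 0 < r x"
    and nontrivial: "\<exists>x\<in>{a..b}. f x \<noteq> 0"
  shows "finite {x\<in>{a..b}. f x = 0}"
proof (rule ccontr)
  assume "infinite {x\<in>{a..b}. f x = 0}"
  moreover have "{x\<in>{a..b}. f x = 0} \<subseteq> {a..b}" by blast
  ultimately obtain c where c: "c \<in> {a..b}" and lim: "c islimpt {x\<in>{a..b}. f x = 0}"
    using compact_Icc[of a b] unfolding compact_eq_Bolzano_Weierstrass by blast
  have not_ev: "\<not> (\<forall>\<^sub>F x in at c within {a..b}. f x \<noteq> 0)"
  proof
    assume "\<forall>\<^sub>F x in at c within {a..b}. f x \<noteq> 0"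
    then obtain d where d: "d > 0"
      "\<forall>x\<in>{a..b}. x \<noteq> c \<and> dist x c < d \<longrightarrow> f x \<noteq> 0"
      unfolding eventually_at by blast
    then show False using lim unfolding islimpt_approachable by blast
  qed
  have deriv: "(f has_real_derivative r c * g c) (at c within {a..b})"
    using sturm_solution_within[OF sol c] .
  have fc: "f c = 0"
  proof (rule ccontr)
    assume "f c \<noteq> 0"
    moreover have "(f \<longlongrightarrow> f c) (at c within {a..b})"
      using sturm_solution_continuous(1)[OF sol] c by (simp add: continuous_on_def)
    ultimately have "\<forall>\<^sub>F x in at c within {a..b}. f x \<noteq> 0"
      by (rule tendsto_imp_eventually_ne[rotated])
    with not_ev show False by contradiction
  qed
  have "r c * g c = 0"
  proof (rule ccontr)
    assume "r c * g c \<noteq> 0"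
    with deriv have "\<forall>\<^sub>F x in at c within {a..b}. (f x - f c) / (x - c) \<noteq> 0"
      unfolding has_field_derivative_iff by (rule tendsto_imp_eventually_ne)
    then have "\<forall>\<^sub>F x in at c within {a..b}. f x \<noteq> 0"
      by (rule eventually_mono) (auto simp: fc)
    with not_ev show False by contradiction
  qed
  with pos[OF c] have "g c = 0" by simp
  from solution_zero_of_zero_data[OF sol cont c fc this] nontrivial show False by blast
qed

section \<open>Comparison of two potentials\<close>

text \<open>The Wronskian argument. At the ends of the interval the Wronskian is \<open>- f\<^sub>2 g\<^sub>1\<close>, and \<open>g\<^sub>1\<close>
  has the sign of \<open>f\<^sub>1'\<close>, which points into the region where \<open>f\<^sub>1\<close> is positive.\<close>

lemma no_common_positive_interval:
  assumes sol1: "sturm_solution r q\<^sub>1 a b f\<^sub>1 g\<^sub>1"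
    and sol2: "sturm_solution r q\<^sub>2 a b f\<^sub>2 g\<^sub>2"
    and r: "\<And>x. x \<in> {a..b} \<Longrightarrow> 0 < r x"
    and q: "\<And>x. x \<in> {a<..<b} \<Longrightarrow> q\<^sub>1 x < q\<^sub>2 x"
    and uv: "u \<in> {a..b}" "v \<in> {a..b}" "u < v"
    and zeros: "f\<^sub>1 u = 0" "f\<^sub>1 v = 0"
    and pos1: "\<And>x. x \<in> {u<..<v} \<Longrightarrow> 0 < f\<^sub>1 x"
    and pos2: "\<And>x. x \<in> {u<..<v} \<Longrightarrow> 0 < f\<^sub>2 x"
  shows False
proof -
  define V where "V x = f\<^sub>1 x * g\<^sub>2 x - f\<^sub>2 x * g\<^sub>1 x" for x
  have sub: "{u..v} \<subseteq> {a..b}" using uv by auto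
  have "V v < V u"
  proof (rule DERIV_neg_imp_decreasing_open[OF uv(3)])
    show "continuous_on {u..v} V"
      unfolding V_def
      by (intro continuous_intros continuous_on_subset[OF _ sub]
          sturm_solution_continuous[OF sol1] sturm_solution_continuous[OF sol2])
    fix x assume "u < x" "x < v"
    then have x: "x \<in> {a<..<b}" and x': "x \<in> {u<..<v}" using uv by auto
    have "(V has_real_derivative - ((q\<^sub>2 x - q\<^sub>1 x) * (f\<^sub>1 x * f\<^sub>2 x))) (at x)"
      unfolding V_def
      by (rule derivative_eq_intros sturm_solution_interior[OF sol1 x]
          sturm_solution_interior[OF sol2 x] refl)+ (simp add: algebra_simps)
    moreover have "- ((q\<^sub>2 x - q\<^sub>1 x) * (f\<^sub>1 x * f\<^sub>2 x)) < 0"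
      using q[OF x] pos1[OF x'] pos2[OF x'] by simp
    ultimately show "\<exists>y. (V has_real_derivative y) (at x) \<and> y < 0" by blast
  qed
  have nonneg: "0 \<le> f\<^sub>2 y" if "y \<in> {u..v}" for y
  proof (rule continuous_ge_on_closure[of "{u<..<v}" f\<^sub>2])
    show "continuous_on (closure {u<..<v}) f\<^sub>2"
      using uv continuous_on_subset[OF sturm_solution_continuous(1)[OF sol2] sub] by simp
    show "y \<in> closure {u<..<v}" using that uv by simp
  qed (use pos2 in \<open>auto intro: less_imp_le\<close>)
  have "0 \<le> r u * g\<^sub>1 u"
  proof (rule ccontr)
    assume "\<not> 0 \<le> r u * g\<^sub>1 u"
    then obtain d where d: "d > 0"
      "\<And>h. 0 < h \<Longrightarrow> u + h \<in> {a..b} \<Longrightarrow> h < d \<Longrightarrow> f\<^sub>1 (u + h) < f\<^sub>1 u"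
      using has_real_derivative_neg_dec_right[OF sturm_solution_within[OF sol1 uv(1)]] by auto
    obtain h where "0 < h" "h < min d (v - u)"
      using dense[of 0 "min d (v - u)"] d(1) uv(3) by auto
    then have h: "0 < h" "h < d" "u + h \<in> {u<..<v}" by auto
    then have "f\<^sub>1 (u + h) < 0" using d(2)[of h] sub zeros by auto
    with pos1[OF h(3)] show False by simp
  qed
  then have "V u \<le> 0"
    using r[OF uv(1)] nonneg[of u] uv(3) zeros by (simp add: V_def zero_le_mult_iff)
  have "r v * g\<^sub>1 v \<le> 0"
  proof (rule ccontr)
    assume "\<not> r v * g\<^sub>1 v \<le> 0"
    then obtain d where d: "d > 0"
      "\<And>h. 0 < h \<Longrightarrow> v - h \<in> {a..b} \<Longrightarrow> h < d \<Longrightarrow> f\<^sub>1 (v - h) < f\<^sub>1 v"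
      using has_real_derivative_pos_inc_left[OF sturm_solution_within[OF sol1 uv(2)]] by auto
    obtain h where "0 < h" "h < min d (v - u)"
      using dense[of 0 "min d (v - u)"] d(1) uv(3) by auto
    then have h: "0 < h" "h < d" "v - h \<in> {u<..<v}" by auto
    then have "f\<^sub>1 (v - h) < 0" using d(2)[of h] sub zeros by auto
    with pos1[OF h(3)] show False by simp
  qed
  then have "0 \<le> V v"
    using r[OF uv(2)] nonneg[of v] uv(3) zeros by (simp add: V_def mult_le_0_iff)
  with \<open>V u \<le> 0\<close> \<open>V v < V u\<close> show False by simp
qed

lemma constant_sign_if_no_zero:
  fixes f :: "real \<Rightarrow> real"
  assumes "continuous_on {u<..<v} f" and "\<And>x. x \<in> {u<..<v} \<Longrightarrow> f x \<noteq> 0"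
  obtains s :: real where "\<And>x. x \<in> {u<..<v} \<Longrightarrow> 0 < s * f x"
proof -
  have "connected (f ` {u<..<v})"
    by (intro connected_continuous_image assms connected_Ioo)
  moreover have "0 \<notin> f ` {u<..<v}" using assms(2) by force
  ultimately have same_sign: "\<not> (f x < 0 \<and> 0 < f y)" if "x \<in> {u<..<v}" "y \<in> {u<..<v}" for x y
    unfolding connected_iff_interval using that by (meson imageI less_imp_le)
  show thesis
  proof (cases "\<exists>x\<in>{u<..<v}. f x < 0")
    case True
    then have "0 < -1 * f y" if "y \<in> {u<..<v}" for y
      using same_sign[OF _ that] assms(2)[OF that] by force
    then show thesis by (rule that)
  next
    case False
    then have "0 < 1 * f y" if "y \<in> {u<..<v}" for y
      using assms(2)[OF that] that by force
    then show thesis by (rule that)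
  qed
qed

text \<open>Since the zeros of \<open>f\<^sub>1\<close> are finite in number, \<open>v\<close> may be replaced by the first zero after
  \<open>u\<close>; on the resulting interval \<open>f\<^sub>1\<close> has constant sign, and rescaling makes both functions
  positive.\<close>

lemma zero_between_zeros:
  assumes sol1: "sturm_solution r q\<^sub>1 a b f\<^sub>1 g\<^sub>1"
    and sol2: "sturm_solution r q\<^sub>2 a b f\<^sub>2 g\<^sub>2"
    and r: "\<And>x. x \<in> {a..b} \<Longrightarrow> 0 < r x"
    and q: "\<And>x. x \<in> {a<..<b} \<Longrightarrow> q\<^sub>1 x < q\<^sub>2 x"
    and finite: "finite {x\<in>{a..b}. f\<^sub>1 x = 0}"
    and uv: "u \<in> {a..b}" "v \<in> {a..b}" "u < v" "f\<^sub>1 u = 0" "f\<^sub>1 v = 0"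
  shows "\<exists>z\<in>{u<..<v}. f\<^sub>2 z = 0"
proof (rule ccontr)
  assume no_zero: "\<not> (\<exists>z\<in>{u<..<v}. f\<^sub>2 z = 0)"
  define Z where "Z = {x\<in>{a..b}. f\<^sub>1 x = 0 \<and> u < x}"
  have "finite Z" by (rule finite_subset[OF _ finite]) (auto simp: Z_def)
  moreover have "v \<in> Z" using uv by (simp add: Z_def)
  ultimately have "Min Z \<in> Z" and "Min Z \<le> v" and least: "\<And>x. x \<in> Z \<Longrightarrow> Min Z \<le> x"
    by (auto intro: Min_in)
  define m where "m = Min Z"
  have m: "m \<in> {a..b}" "u < m" "f\<^sub>1 m = 0" "m \<le> v"
    using \<open>Min Z \<in> Z\<close> \<open>Min Z \<le> v\<close> by (auto simp: Z_def m_def)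
  have no_zero1: "f\<^sub>1 x \<noteq> 0" if "x \<in> {u<..<m}" for x
    using that least[of x] uv m by (auto simp: Z_def m_def)
  have no_zero2: "f\<^sub>2 x \<noteq> 0" if "x \<in> {u<..<m}" for x
    using that no_zero m(4) by auto
  have sub: "{u<..<m} \<subseteq> {a..b}" using uv m by auto
  obtain s\<^sub>1 where s1: "\<And>x. x \<in> {u<..<m} \<Longrightarrow> 0 < s\<^sub>1 * f\<^sub>1 x"
    using constant_sign_if_no_zero no_zero1
      continuous_on_subset[OF sturm_solution_continuous(1)[OF sol1] sub] by blast
  obtain s\<^sub>2 where s2: "\<And>x. x \<in> {u<..<m} \<Longrightarrow> 0 < s\<^sub>2 * f\<^sub>2 x"
    using constant_sign_if_no_zero no_zero2
      continuous_on_subset[OF sturm_solution_continuous(1)[OF sol2] sub] by blast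
  show False
    by (rule no_common_positive_interval[OF sturm_solution_scale[OF sol1, of s\<^sub>1]
          sturm_solution_scale[OF sol2, of s\<^sub>2] r q uv(1) m(1,2) _ _ s1 s2])
       (simp_all add: uv m)
qed

text \<open>A zero \<open>x > a\<close> of \<open>f\<^sub>1\<close> is sent into the gap between the zero of \<open>f\<^sub>1\<close> preceding it and \<open>x\<close>.
  The gaps are disjoint and lie to the right of \<open>a\<close>, whence injectivity.\<close>

lemma zeros_lepoll:
  fixes f\<^sub>1 f\<^sub>2 :: "real \<Rightarrow> real"
  assumes finite: "finite {x\<in>{a..b}. f\<^sub>1 x = 0}"
    and interlace: "\<And>u v. u \<in> {a..b} \<Longrightarrow> v \<in> {a..b} \<Longrightarrow> u < v \<Longrightarrow> f\<^sub>1 u = 0 \<Longrightarrow> f\<^sub>1 v = 0 \<Longrightarrow>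
      \<exists>z\<in>{u<..<v}. f\<^sub>2 z = 0"
    and start: "f\<^sub>1 a = 0" "f\<^sub>2 a = 0"
  shows "{x\<in>{a..b}. f\<^sub>1 x = 0} \<lesssim> {x\<in>{a..b}. f\<^sub>2 x = 0}"
proof -
  define Z where "Z = {x\<in>{a..b}. f\<^sub>1 x = 0}"
  have gap: "\<exists>z\<in>{a..b}. f\<^sub>2 z = 0 \<and> z \<le> x \<and> (\<forall>y\<in>Z. y < x \<longrightarrow> y < z)" if x: "x \<in> Z" for x
  proof (cases "x = a")
    case True
    with x start show ?thesis by (intro bexI[of _ a]) (auto simp: Z_def)
  next
    case False
    define P where "P = {y\<in>Z. y < x}"
    have "finite P" unfolding P_def Z_def by (rule finite_subset[OF _ finite]) auto
    moreover have "a \<in> P" using x False start by (auto simp: P_def Z_def)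
    ultimately have "Max P \<in> P" and greatest: "\<And>y. y \<in> P \<Longrightarrow> y \<le> Max P"
      by (auto intro: Max_in)
    then obtain z where z: "z \<in> {Max P<..<x}" "f\<^sub>2 z = 0"
      using interlace[of "Max P" x] x by (auto simp: P_def Z_def)
    show ?thesis
    proof (intro bexI[of _ z] conjI ballI impI)
      show "z \<in> {a..b}" using z \<open>Max P \<in> P\<close> x by (auto simp: P_def Z_def)
      show "y < z" if "y \<in> Z" "y < x" for y
        using greatest[of y] that z by (auto simp: P_def)
    qed (use z in auto)
  qed
  then obtain h where h: "\<And>x. x \<in> Z \<Longrightarrow> h x \<in> {a..b} \<and> f\<^sub>2 (h x) = 0 \<and> h x \<le> x \<and>
      (\<forall>y\<in>Z. y < x \<longrightarrow> y < h x)"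
    by metis
  have "h x < h y" if "x \<in> Z" "y \<in> Z" "x < y" for x y
    using h[OF that(1)] h[OF that(2)] that by force
  then have "inj_on h Z"
    by (intro inj_onI) (metis less_irrefl linorder_less_linear)
  then show ?thesis
    unfolding lepoll_def Z_def[symmetric] using h by (intro exI[of _ h]) auto
qed

section \<open>Application to the operators in a fixed environment\<close>

lemma sturm_solution_of_L_op:
  assumes f: "f \<in> D0 w a b" and L: "\<And>x. x \<in> {a<..<b} \<Longrightarrow> L_op w a b l f x = 0"
  shows "sturm_solution (\<lambda>x. exp (w x)) (\<lambda>x. 2 * l * exp (- w x)) a b f (quasi_deriv w a b f)"
  unfolding sturm_solution_def
proof (intro conjI ballI)
  note diff = f[unfolded D0_def mem_Collect_eq]
  show "continuous_on {a..b} (quasi_deriv w a b f)"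
    using diff by (blast intro: differentiable_imp_continuous_on)
  fix x assume x: "x \<in> {a..b}"
  then have "(f has_real_derivative vector_derivative f (at x within {a..b})) (at x within {a..b})"
    using diff by (simp add: differentiable_on_def has_real_derivative_iff_has_vector_derivative
        vector_derivative_works)
  then show "(f has_real_derivative exp (w x) * quasi_deriv w a b f x) (at x within {a..b})"
    by (simp add: quasi_deriv_def mult.assoc[symmetric] exp_add[symmetric])
next
  note diff = f[unfolded D0_def mem_Collect_eq]
  fix x assume x: "x \<in> {a<..<b}"
  then have "(quasi_deriv w a b f has_real_derivative
      vector_derivative (quasi_deriv w a b f) (at x within {a..b})) (at x within {a..b})"
    using diff by (simp add: differentiable_on_def has_real_derivative_iff_has_vector_derivative
        vector_derivative_works)
  moreover have "vector_derivative (quasi_deriv w a b f) (at x within {a..b})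
      = - (2 * l * exp (- w x)) * f x"
    using L[OF x] by (simp add: L_op_def)
  ultimately show "(quasi_deriv w a b f has_real_derivative - (2 * l * exp (- w x)) * f x) (at x)"
    using x by (simp add: at_within_Icc_at)
qed

theorem theorem11:
  fixes M :: "'w measure" and W :: "real \<Rightarrow> 'w \<Rightarrow> real" and a b :: real
  assumes "two_sided_brownian_motion M W" and "a < b"
  shows "AE \<omega> in M. \<forall>(l\<^sub>1::real) (l\<^sub>2::real) (\<phi>\<^sub>1::real \<Rightarrow> real) (\<phi>\<^sub>2::real \<Rightarrow> real).
    l\<^sub>1 < l\<^sub>2 \<longrightarrow>
    \<phi>\<^sub>1 \<in> D0 (\<lambda>x. W x \<omega>) a b \<longrightarrow>
    \<phi>\<^sub>2 \<in> D0 (\<lambda>x. W x \<omega>) a b \<longrightarrow>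
    (\<forall>x\<in>{a<..<b}. L_op (\<lambda>x. W x \<omega>) a b l\<^sub>1 \<phi>\<^sub>1 x = 0) \<longrightarrow>
    (\<forall>x\<in>{a<..<b}. L_op (\<lambda>x. W x \<omega>) a b l\<^sub>2 \<phi>\<^sub>2 x = 0) \<longrightarrow>
    (\<exists>x\<in>{a..b}. \<phi>\<^sub>1 x \<noteq> 0) \<longrightarrow>
    (\<forall>u\<in>{a..b}. \<forall>v\<in>{a..b}. u < v \<and> \<phi>\<^sub>1 u = 0 \<and> \<phi>\<^sub>1 v = 0 \<longrightarrow> (\<exists>z\<in>{u<..<v}. \<phi>\<^sub>2 z = 0)) \<and>
    (\<phi>\<^sub>1 a = 0 \<and> \<phi>\<^sub>2 a = 0 \<longrightarrow> {x\<in>{a..b}. \<phi>\<^sub>1 x = 0} \<lesssim> {x\<in>{a..b}. \<phi>\<^sub>2 x = 0})"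
  using two_sided_brownian_motion.continuous_paths[OF assms(1)]
proof (rule eventually_mono, intro allI impI)
  fix \<omega> :: 'w and l\<^sub>1 l\<^sub>2 :: real and \<phi>\<^sub>1 \<phi>\<^sub>2 :: "real \<Rightarrow> real"
  let ?w = "\<lambda>x. W x \<omega>"
  let ?r = "\<lambda>x. exp (?w x)" and ?q = "\<lambda>l x. 2 * l * exp (- ?w x)"
  assume cont: "continuous_on UNIV ?w" and l: "l\<^sub>1 < l\<^sub>2"
    and D: "\<phi>\<^sub>1 \<in> D0 ?w a b" "\<phi>\<^sub>2 \<in> D0 ?w a b"
    and L: "\<forall>x\<in>{a<..<b}. L_op ?w a b l\<^sub>1 \<phi>\<^sub>1 x = 0" "\<forall>x\<in>{a<..<b}. L_op ?w a b l\<^sub>2 \<phi>\<^sub>2 x = 0"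
    and nontrivial: "\<exists>x\<in>{a..b}. \<phi>\<^sub>1 x \<noteq> 0"
  have sol1: "sturm_solution ?r (?q l\<^sub>1) a b \<phi>\<^sub>1 (quasi_deriv ?w a b \<phi>\<^sub>1)"
    using D(1) L(1) by (intro sturm_solution_of_L_op) auto
  have sol2: "sturm_solution ?r (?q l\<^sub>2) a b \<phi>\<^sub>2 (quasi_deriv ?w a b \<phi>\<^sub>2)"
    using D(2) L(2) by (intro sturm_solution_of_L_op) auto
  have "continuous_on {a..b} ?w" using cont by (rule continuous_on_subset) simp
  then have finite: "finite {x\<in>{a..b}. \<phi>\<^sub>1 x = 0}"
    using nontrivial by (intro finite_zeros[OF sol1] continuous_intros) auto
  have interlace: "\<exists>z\<in>{u<..<v}. \<phi>\<^sub>2 z = 0"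
    if "u \<in> {a..b}" "v \<in> {a..b}" "u < v" "\<phi>\<^sub>1 u = 0" "\<phi>\<^sub>1 v = 0" for u v
    using l by (intro zero_between_zeros[OF sol1 sol2 _ _ finite that]) auto
  show "(\<forall>u\<in>{a..b}. \<forall>v\<in>{a..b}. u < v \<and> \<phi>\<^sub>1 u = 0 \<and> \<phi>\<^sub>1 v = 0 \<longrightarrow> (\<exists>z\<in>{u<..<v}. \<phi>\<^sub>2 z = 0)) \<and>
    (\<phi>\<^sub>1 a = 0 \<and> \<phi>\<^sub>2 a = 0 \<longrightarrow> {x\<in>{a..b}. \<phi>\<^sub>1 x = 0} \<lesssim> {x\<in>{a..b}. \<phi>\<^sub>2 x = 0})"
    using interlace zeros_lepoll[OF finite interlace] by blast
qed

end
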